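(* Let $\beta\in(0,1)$ be fixed and let the secondary users' transmission range and interference range be related by $r_p=\beta r_I$. For a fixed $R_I>0$, the quantity $$\frac{\lambda_c(1)}{4\max\{R_I^2,r_I^2\}-r_p^2}$$ (an upper bound on the critical density $\overline{\lambda^*_{PT}}$ of the primary transmitters), as a function of $r_I>0$, is maximized when the primary and secondary networks have matching interference ranges, $r_I=R_I$.
   Context: $r_I$ is the interference range of the secondary users, $R_I$ the interference range of the primary users, and $r_p$ the transmission range of the secondary users. The constant $\lambda_c(1)\in(0,\infty)$ is the critical density, for a homogeneous Poisson point process in $\mathbb{R}^2$ with two points joined when their distance is at most $1$, for the a.s. existence of an infinite connected component. Origin of the quantity (not needed to evaluate the claim): primary transmitters form a Poisson process of density $\lambda_{PT}$ in $\mathbb{R}^2$, each with a receiver uniform in the disk of radius $R_p$ around it; secondary users form an independent Poisson process of density $\lambda_S$; two secondary users are linked if they are within distance $r_p$ and neither has a primary transmitter within $R_I$ or a primary receiver within $r_I$. $\overline{\lambda^*_{PT}}$ is the supremum of $\lambda_{PT}$ for which some finite $\lambda_S$ makes this graph a.s. contain an infinite connected component. *)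

theory Defs
  imports "HOL-Probability.Probability"
begin

definition configs :: "(real ^ 2) set set" where
  "configs = {\<omega>. \<forall>B. bounded B \<longrightarrow> finite (\<omega> \<inter> B)}"

definition config_algebra :: "(real ^ 2) set measure" where
  "config_algebra = sigma configs
     {{\<omega> \<in> configs. card (\<omega> \<inter> B) = n} | B n. B \<in> sets borel \<and> bounded B}"

text \<open>The law of a homogeneous Poisson point process of density \<open>d\<close> in the plane, as a measure
  on the locally finite point sets; being determined by \<open>d\<close>, it serves as canonical probability
  space. Independence is required of the counts on finitely many disjoint bounded Borel sets.\<close>

definition homogeneous_ppp :: "real \<Rightarrow> (real ^ 2) set measure \<Rightarrow> bool" where
  "homogeneous_ppp d M \<longleftrightarrow>
     prob_space M \<and>
     space M = space config_algebra \<and> sets M = sets config_algebra \<and>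
     (\<forall>B n. B \<in> sets borel \<longrightarrow> bounded B \<longrightarrow>
        measure M {\<omega> \<in> space M. card (\<omega> \<inter> B) = n} =
          exp (- (d * measure lborel B)) * (d * measure lborel B) ^ n / fact n) \<and>
     (\<forall>(I :: nat set) B. finite I \<longrightarrow> (\<forall>i\<in>I. B i \<in> sets borel \<and> bounded (B i)) \<longrightarrow>
        disjoint_family_on B I \<longrightarrow>
        prob_space.indep_vars M (\<lambda>_. count_space UNIV) (\<lambda>i \<omega>. card (\<omega> \<inter> B i)) I)"

definition links :: "real \<Rightarrow> (real ^ 2) set \<Rightarrow> ((real ^ 2) \<times> (real ^ 2)) set" where
  "links r \<omega> = {(x, y). x \<in> \<omega> \<and> y \<in> \<omega> \<and> x \<noteq> y \<and> dist x y \<le> r}"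

definition percolates :: "real \<Rightarrow> (real ^ 2) set \<Rightarrow> bool" where
  "percolates r \<omega> \<longleftrightarrow> (\<exists>x\<in>\<omega>. infinite ((links r \<omega>)\<^sup>* `` {x}))"

text \<open>Extended real, so that the infimum needs no nonemptiness or boundedness side conditions.\<close>

definition critical_density :: "real \<Rightarrow> ereal" where
  "critical_density r =
     Inf {ereal d | d. 0 < d \<and> (\<exists>M. homogeneous_ppp d M \<and> (AE \<omega> in M. percolates r \<omega>))}"

end

theory Submission imports Defs begin

text \<open>The numerator is a constant that is nonnegative
  (\<open>critical_density_nonneg\<close>), so the quotient is largest where the denominator is
  smallest and positive. With R = \<open>R_I\<close>, the denominator is 4 R^2 - \<beta>^2 r^2 for r
  \<le> R, which decreases in r, and (4 - \<beta>^2) r^2 for r \<ge> R, which increases. Its minimum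
  is at the kink r = R (\<open>matching_range_minimizes\<close>).\<close>

lemma critical_density_nonneg: "0 \<le> critical_density r"
  unfolding critical_density_def by (rule Inf_greatest) auto

text \<open>The bound 2 on \<bar>\<beta>\<bar> is what keeps the slope 4 - \<beta>^2 in r^2
  nonnegative beyond R.\<close>

lemma matching_range_minimizes:
  fixes \<beta> R r :: real
  assumes "\<bar>\<beta>\<bar> \<le> 2" and "0 \<le> R" and "0 \<le> r"
  shows "4 * max (R\<^sup>2) (R\<^sup>2) - (\<beta> * R)\<^sup>2 \<le> 4 * max (R\<^sup>2) (r\<^sup>2) - (\<beta> * r)\<^sup>2"
proof (cases "r \<le> R")
  case True
  then have "r\<^sup>2 \<le> R\<^sup>2"
    using assms by (intro power_mono)
  moreover from this have "\<beta>\<^sup>2 * r\<^sup>2 \<le> \<beta>\<^sup>2 * R\<^sup>2"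
    by (intro mult_left_mono) auto
  ultimately show ?thesis
    by (simp add: power_mult_distrib)
next
  case False
  then have "R\<^sup>2 \<le> r\<^sup>2"
    using assms by (intro power_mono) auto
  moreover have "\<beta>\<^sup>2 \<le> 4"
    using assms(1) abs_le_square_iff[of \<beta> 2] by simp
  ultimately have "(4 - \<beta>\<^sup>2) * R\<^sup>2 \<le> (4 - \<beta>\<^sup>2) * r\<^sup>2"
    by (intro mult_left_mono) auto
  with \<open>R\<^sup>2 \<le> r\<^sup>2\<close> show ?thesis
    by (simp add: power_mult_distrib algebra_simps)
qed

theorem theorem5:
  fixes \<beta> R_I :: real
  assumes "0 < \<beta>" and "\<beta> < 1" and "0 < R_I"
  shows "is_arg_max
    (\<lambda>r_I. let r_p = \<beta> * r_I in
       critical_density 1 / ereal (4 * max (R_I\<^sup>2) (r_I\<^sup>2) - r_p\<^sup>2))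
    (\<lambda>r_I. 0 < r_I) R_I"
proof -
  define D where "D r = 4 * max (R_I\<^sup>2) (r\<^sup>2) - (\<beta> * r)\<^sup>2" for r
  \<comment> \<open>Inversion in \<open>ereal\<close> reverses order among nonnegative values, so
    the sign of the smallest denominator is settled here.\<close>
  have "(\<beta> * R_I)\<^sup>2 < R_I\<^sup>2"
    using assms by (intro power_strict_mono) auto
  also have "\<dots> \<le> 4 * R_I\<^sup>2"
    by simp
  finally have "0 < D R_I"
    by (simp add: D_def)
  have "critical_density 1 / ereal (D r) \<le> critical_density 1 / ereal (D R_I)" if "0 < r" for r
  proof -
    have "D R_I \<le> D r"
      unfolding D_def using assms that by (intro matching_range_minimizes) auto
    then show ?thesis
      unfolding divide_ereal_def using \<open>0 < D R_I\<close>
      by (intro ereal_mult_left_mono ereal_inverse_antimono critical_density_nonneg) auto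
  qed
  then show ?thesis
    \<comment> \<open>\<open>is_arg_max\<close> asks that no admissible point be strictly better;
      \<open>leD\<close> turns the bound into that form.\<close>
    using \<open>0 < R_I\<close> unfolding is_arg_max_def Let_def D_def by (blast dest: leD)
qed

end
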